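(* Let $G$ be a simple undirected graph on $n$ vertices $v_1,\dots,v_n$ with Seidel matrix $S=S(G)$. Suppose that the absolute values of the eigenvalues of $S$ take exactly two distinct values $a>b\ge 0$, i.e. $\{|\theta| : \theta \text{ an eigenvalue of } S\}=\{a,b\}$. Then for every vertex $v_i$, $$\mathcal{E}_S(v_i)= b+(a-b)\,\frac{n-1-b^2}{a^2-b^2}.$$
   Context: All graphs are finite, simple and undirected. The Seidel matrix of a graph $G$ with vertex set $\{v_1,\dots,v_n\}$ is the real symmetric $n\times n$ matrix $S(G)=[s_{ij}]$ with $s_{ii}=0$, and for $i\neq j$, $s_{ij}=-1$ if $v_i$ and $v_j$ are adjacent and $s_{ij}=1$ otherwise; equivalently $S(G)=J-I-2A(G)$, where $A(G)$ is the adjacency matrix, $J$ the all-ones matrix and $I$ the identity. For a real symmetric matrix $S$, $|S|=(S^2)^{1/2}$ is the positive semidefinite square root of $S^2$. The vertex Seidel energy of $v_i$ is $\mathcal{E}_S(v_i)=|S(G)|_{ii}$, the $i$-th diagonal entry of $|S(G)|$; equivalently, if $S=W\operatorname{diag}(\theta_1,\dots,\theta_n)W^\top$ with $W=[w_{ij}]$ orthogonal, $\mathcal{E}_S(v_i)=\sum_{j=1}^n w_{ij}^2|\theta_j|$. *)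

theory Defs
  imports "Graph_Theory.Digraph" "Jordan_Normal_Form.Char_Poly"
begin

text \<open>
  A finite simple undirected graph is a symmetric digraph without loops and parallel arcs, i.e. an
  instance of the locale \<^locale>\<open>graph\<close>. The list \<open>vs\<close> is an enumeration of the vertices without
  repetition; list and matrix indices start at 0.
\<close>

definition seidel_matrix :: "('a, 'b) pre_digraph \<Rightarrow> 'a list \<Rightarrow> real mat" where
  "seidel_matrix G vs = mat (length vs) (length vs)
     (\<lambda>(i, j). if i = j then 0 else if vs ! i \<rightarrow>\<^bsub>G\<^esub> vs ! j then -1 else 1)"

definition pos_semidef_mat :: "real mat \<Rightarrow> bool" where
  "pos_semidef_mat B \<longleftrightarrow> transpose_mat B = B \<and>
     (\<forall>x \<in> carrier_vec (dim_row B). 0 \<le> x \<bullet> (B *\<^sub>v x))"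

text \<open>
  Meaningful for positive semidefinite \<open>A\<close>, whose positive semidefinite square root exists and is
  unique. No dimension condition is needed: a symmetric \<open>B\<close> is square, and \<open>B * B = A\<close> forces it to
  have the size of \<open>A\<close>.
\<close>

definition psd_sqrt_mat :: "real mat \<Rightarrow> real mat" where
  "psd_sqrt_mat A = (THE B. pos_semidef_mat B \<and> B * B = A)"

definition abs_mat :: "real mat \<Rightarrow> real mat" where
  "abs_mat S = psd_sqrt_mat (S * S)"

definition vertex_seidel_energy :: "('a, 'b) pre_digraph \<Rightarrow> 'a list \<Rightarrow> nat \<Rightarrow> real" where
  "vertex_seidel_energy G vs i = abs_mat (seidel_matrix G vs) $$ (i, i)"

end

theory Submission
  imports Defs "Jordan_Normal_Form.Schur_Decomposition"
begin

text \<open>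
  If every eigenvalue of the symmetric matrix \<open>S\<close> has absolute value \<open>a\<close> or \<open>b\<close>, then
  \<open>(S\<^sup>2 - a\<^sup>2)(S\<^sup>2 - b\<^sup>2) = 0\<close>, hence \<open>B = (S\<^sup>2 + ab) / (a + b)\<close> satisfies \<open>B\<^sup>2 = S\<^sup>2\<close>. As \<open>B\<close> is
  positive semidefinite and a polynomial in \<open>S\<^sup>2\<close>, it commutes with every square root of \<open>S\<^sup>2\<close> and
  therefore equals \<open>|S|\<close>. The diagonal of \<open>S\<^sup>2\<close> is constant \<open>n - 1\<close>, which determines that of \<open>B\<close>.

  Instead of the spectral theorem, the annihilating identity uses that the left-hand side \<open>N\<close> is
  symmetric and, by Schur triangularization of \<open>S\<close>, similar to a strictly upper triangular matrix;
  so the sum of the squares of the entries of \<open>N\<close>, being the trace of \<open>N\<^sup>2\<close>, vanishes.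
\<close>

section \<open>Traces, triangular products and symmetric matrices\<close>

lemma symmetric_mat_index:
  assumes "transpose_mat A = A" "A \<in> carrier_mat n n" "i < n" "j < n"
  shows "A $$ (j, i) = A $$ (i, j)"
  using assms by (metis carrier_matD index_transpose_mat(1))

lemma trace_mult_comm:
  fixes A B :: "'a :: comm_ring_1 mat"
  assumes "A \<in> carrier_mat n m" "B \<in> carrier_mat m n"
  shows "(\<Sum>i<n. (A * B) $$ (i, i)) = (\<Sum>i<m. (B * A) $$ (i, i))"
proof -
  have "(\<Sum>i<n. (A * B) $$ (i, i)) = (\<Sum>i<n. \<Sum>j<m. A $$ (i, j) * B $$ (j, i))"
    using assms by (auto simp: scalar_prod_def lessThan_atLeast0 intro!: sum.cong)
  also have "\<dots> = (\<Sum>j<m. \<Sum>i<n. B $$ (j, i) * A $$ (i, j))"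
    by (subst sum.swap) (simp add: mult.commute)
  also have "\<dots> = (\<Sum>i<m. (B * A) $$ (i, i))"
    using assms by (auto simp: scalar_prod_def lessThan_atLeast0 intro!: sum.cong)
  finally show ?thesis .
qed

lemma upper_triangular_mult:
  fixes A B :: "'a :: comm_ring_1 mat"
  assumes A: "A \<in> carrier_mat n n" "upper_triangular A"
    and B: "B \<in> carrier_mat n n" "upper_triangular B"
  shows "upper_triangular (A * B)"
    and "\<And>i. i < n \<Longrightarrow> (A * B) $$ (i, i) = A $$ (i, i) * B $$ (i, i)"
proof -
  show "upper_triangular (A * B)"
  proof (rule upper_triangularI)
    fix i j assume ij: "j < i" "i < dim_row (A * B)"
    have "A $$ (i, k) * B $$ (k, j) = 0" if "k < n" for k
    proof (cases "k < i")
      case True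
      then show ?thesis using A ij upper_triangularD[of A k i] by simp
    next
      case False
      then show ?thesis using A B ij that upper_triangularD[of B j k] by simp
    qed
    then show "(A * B) $$ (i, j) = 0"
      using A B ij by (auto simp: scalar_prod_def intro!: sum.neutral)
  qed
  fix i assume i: "i < n"
  have "A $$ (i, k) * B $$ (k, i) = 0" if "k < n" "k \<noteq> i" for k
    using that A B i upper_triangularD[of A k i] upper_triangularD[of B i k]
    by (cases "k < i") auto
  then have "(\<Sum>k<n. A $$ (i, k) * B $$ (k, i)) = (\<Sum>k\<in>{i}. A $$ (i, k) * B $$ (k, i))"
    using i by (intro sum.mono_neutral_right) auto
  then show "(A * B) $$ (i, i) = A $$ (i, i) * B $$ (i, i)"
    using A B i by (auto simp: scalar_prod_def lessThan_atLeast0)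
qed

lemma symmetric_mat_eq_0_if_similar_strictly_upper:
  fixes N :: "real mat"
  assumes N: "N \<in> carrier_mat n n" "transpose_mat N = N"
    and sim: "similar_mat_wit N V P Q"
    and V: "upper_triangular V" "\<And>i. i < n \<Longrightarrow> V $$ (i, i) = 0"
  shows "N = 0\<^sub>m n n"
proof -
  note sim = similar_mat_witD2[OF N(1) sim]
  have "N * N = P * (V * V * Q)"
  proof -
    have "N * N = P * V * (Q * P) * V * Q"
      using sim(3-7) by (simp add: assoc_mult_mat[of _ n n _ n _ n])
    then show ?thesis
      using sim(2,4-7) by (simp add: assoc_mult_mat[of _ n n _ n _ n])
  qed
  \<comment> \<open>Cyclicity of the trace moves \<open>P\<close> to the right end, where
    \<open>Q * P\<close> is the identity; what remains is the trace of \<open>V * V\<close>, whose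
    diagonal consists of squares of zeros.\<close>
  then have "(\<Sum>i<n. (N * N) $$ (i, i)) = (\<Sum>i<n. (V * V * Q * P) $$ (i, i))"
    using sim(4-7) trace_mult_comm[of P n n "V * V * Q"] by simp
  also have "V * V * Q * P = V * V"
    using sim(2,4-7) by (simp add: assoc_mult_mat[of _ n n _ n _ n])
  also have "(\<Sum>i<n. (V * V) $$ (i, i)) = 0"
    using upper_triangular_mult(2)[OF sim(5) V(1) sim(5) V(1)] V(2) by simp
  finally have "(\<Sum>i<n. \<Sum>j<n. N $$ (i, j) * N $$ (j, i)) = 0"
    using N(1) by (simp add: scalar_prod_def lessThan_atLeast0)
  moreover have "N $$ (j, i) = N $$ (i, j)" if "i < n" "j < n" for i j
    using symmetric_mat_index[OF N(2,1) that] .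
  ultimately have "(\<Sum>i<n. \<Sum>j<n. (N $$ (i, j))\<^sup>2) = 0"
    by (simp add: power2_eq_square)
  then have "\<forall>i<n. \<forall>j<n. N $$ (i, j) = 0"
    by (simp add: sum_nonneg_eq_0_iff sum_nonneg)
  then show ?thesis
    using N(1) by auto
qed

section \<open>Real spectrum of a real symmetric matrix\<close>

text \<open>The Hermitian argument: the product of \<open>conjugate v\<close> with
  \<open>?A *\<^sub>v v\<close> equals both \<open>e\<close> and \<open>cnj e\<close> times the
  squared norm of \<open>v\<close>, which is nonzero. The scalar product is bilinear here, so the
  conjugation is written out.\<close>

lemma eigenvalue_real_if_symmetric:
  fixes A :: "real mat"
  assumes A: "A \<in> carrier_mat n n" "transpose_mat A = A"
    and e: "eigenvalue (map_mat complex_of_real A) e"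
  shows "e \<in> \<real>"
proof -
  let ?A = "map_mat complex_of_real A"
  obtain v where v: "v \<in> carrier_vec n" "v \<noteq> 0\<^sub>v n" "?A *\<^sub>v v = e \<cdot>\<^sub>v v"
    using e A(1) by (auto simp: eigenvalue_def eigenvector_def)
  have Ac: "?A \<in> carrier_mat n n" using A(1) by simp
  have cv: "conjugate v \<in> carrier_vec n" using v(1) by simp
  have conj: "?A *\<^sub>v conjugate v = conjugate (?A *\<^sub>v v)"
    using A(1) v(1) by (intro eq_vecI) (auto simp: scalar_prod_def)
  have "e * (conjugate v \<bullet> v) = conjugate v \<bullet> (?A *\<^sub>v v)"
    using v by simp
  also have "\<dots> = (transpose_mat ?A *\<^sub>v conjugate v) \<bullet> v"
    using transpose_vec_mult_scalar[OF Ac v(1) cv] by simp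
  also have "transpose_mat ?A = ?A" using A(2) by (simp add: map_mat_transpose)
  also have "(?A *\<^sub>v conjugate v) \<bullet> v = cnj e * (conjugate v \<bullet> v)"
    using v cv conj by (simp add: conjugate_smult_vec)
  finally have "(e - cnj e) * (conjugate v \<bullet> v) = 0" by (simp add: algebra_simps)
  moreover have "conjugate v \<bullet> v \<noteq> 0"
    using v cv comm_scalar_prod[OF cv v(1)] by simp
  ultimately have "cnj e = e" by simp
  then show ?thesis by (metis Reals_cnj_iff)
qed

text \<open>Supplies the real linear factors that Schur decomposition over the reals needs. The
  complex roots are real, so the complex factorization is the image of a real one, and the embedding
  of polynomials is injective.\<close>

lemma char_poly_symmetric_splits:
  fixes A :: "real mat"
  assumes A: "A \<in> carrier_mat n n" "transpose_mat A = A"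
  obtains es where "char_poly A = (\<Prod>e\<leftarrow>es. [:- e, 1:])"
proof -
  interpret mp: map_poly_inj_idom_hom complex_of_real ..
  let ?A = "map_mat complex_of_real A"
  have Ac: "?A \<in> carrier_mat n n" using A(1) by simp
  obtain es where es: "char_poly ?A = (\<Prod>e\<leftarrow>es. [:- e, 1:])"
    using char_poly_factorized[OF Ac] by auto
  have "e \<in> \<real>" if "e \<in> set es" for e
  proof (rule eigenvalue_real_if_symmetric[OF A])
    have "poly (char_poly ?A) e = 0"
      using that unfolding es by (auto simp: poly_prod_list prod_list_zero_iff)
    then show "eigenvalue ?A e" using eigenvalue_root_char_poly[OF Ac] by simp
  qed
  then have "map (complex_of_real \<circ> Re) es = es" by (auto simp: map_idI)
  then have "char_poly ?A = (\<Prod>e\<leftarrow>map Re es. [:- complex_of_real e, 1:])"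
    unfolding es by (metis (no_types, lifting) comp_def map_eq_conv map_map)
  also have "\<dots> = map_poly complex_of_real (\<Prod>e\<leftarrow>map Re es. [:- e, 1:])"
    by (simp add: mp.hom_prod_list o_def)
  finally have "map_poly complex_of_real (char_poly A) =
      map_poly complex_of_real (\<Prod>e\<leftarrow>map Re es. [:- e, 1:])"
    unfolding of_real_hom.char_poly_hom[OF A(1)] .
  then have "char_poly A = (\<Prod>e\<leftarrow>map Re es. [:- e, 1:])"
    by (rule mp.injectivity)
  then show ?thesis by (rule that)
qed

section \<open>Uniqueness of commuting positive semidefinite square roots\<close>

text \<open>Such a \<open>y\<close> minimizes the nonnegative form of \<open>B\<close>, so the
  derivative there in the direction \<open>B *\<^sub>v y\<close>, which is twice the squared norm of
  that vector, must be zero.\<close>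

lemma psd_eq_0_if_quadratic_form_0:
  assumes B: "B \<in> carrier_mat n n" "pos_semidef_mat B"
    and y: "y \<in> carrier_vec n" "y \<bullet> (B *\<^sub>v y) = 0"
  shows "B *\<^sub>v y = 0\<^sub>v n"
proof -
  define z where "z = B *\<^sub>v y"
  define p q where "p = z \<bullet> z" and "q = z \<bullet> (B *\<^sub>v z)"
  have z: "z \<in> carrier_vec n" using B y by (simp add: z_def)
  have Bz: "B *\<^sub>v z \<in> carrier_vec n" using B z by simp
  have "y \<bullet> (B *\<^sub>v z) = (B *\<^sub>v y) \<bullet> z"
    using transpose_vec_mult_scalar[OF B(1) z y(1)] B(2) by (simp add: pos_semidef_mat_def)
  then have yBz: "y \<bullet> (B *\<^sub>v z) = p" by (simp add: p_def z_def)
  \<comment> \<open>The quadratic form at \<open>y + t z\<close> has no constant term, so its linear coefficient vanishes.\<close>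
  have quad: "0 \<le> 2 * t * p + t\<^sup>2 * q" for t :: real
  proof -
    have "0 \<le> (y + t \<cdot>\<^sub>v z) \<bullet> (B *\<^sub>v (y + t \<cdot>\<^sub>v z))"
      using B y z by (simp add: pos_semidef_mat_def)
    also have "B *\<^sub>v (y + t \<cdot>\<^sub>v z) = z + t \<cdot>\<^sub>v (B *\<^sub>v z)"
      using B y z by (simp add: mult_add_distrib_mat_vec[of _ n n] mult_mat_vec z_def)
    also have "(y + t \<cdot>\<^sub>v z) \<bullet> (z + t \<cdot>\<^sub>v (B *\<^sub>v z)) = 2 * t * p + t\<^sup>2 * q"
      using y z Bz yBz
      by (simp add: scalar_prod_add_distrib[of _ n] add_scalar_prod_distrib[of _ n]
          smult_scalar_prod_distrib[of _ n] scalar_prod_smult_distrib[of _ n]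
          z_def[symmetric] p_def[symmetric] q_def[symmetric] power2_eq_square algebra_simps)
    finally show ?thesis .
  qed
  have q: "q \<ge> 0" using B z by (simp add: pos_semidef_mat_def q_def)
  have p0: "p \<ge> 0" using conjugate_square_ge_0_vec[of z] by (simp add: p_def)
  have "p = 0"
  proof (rule ccontr)
    assume "p \<noteq> 0"
    then have "p > 0" using p0 by simp
    \<comment> \<open>The minimizing parameter \<open>- p / q\<close> breaks down for
      \<open>q = 0\<close>; enlarging the denominator by 1 avoids this and keeps the value negative,
      since \<open>q - 2 * s = - q - 2\<close>.\<close>
    define s where "s = q + 1"
    have s: "s > 0" using q by (simp add: s_def)
    have "2 * (- p / s) * p + (- p / s)\<^sup>2 * q = p\<^sup>2 * (q - 2 * s) / s\<^sup>2"
      using s by (simp add: field_simps power2_eq_square)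
    also have "\<dots> < 0"
      using \<open>p > 0\<close> q s by (intro divide_neg_pos mult_pos_neg) (auto simp: s_def)
    finally show False using quad[of "- p / s"] by simp
  qed
  then show ?thesis using z conjugate_square_eq_0_vec[of z n] by (simp add: p_def z_def)
qed

text \<open>By commutation, (B + C)(B - C) = B^2 - C^2 = 0. For y = (B - C)x the forms of
  \<open>B\<close> and \<open>C\<close> at y therefore add up to 0, so both vanish. Hence By = Cy =
  0, thus (B - C)y = 0, and symmetry of B - C turns the squared norm of y into the product of (B -
  C)y and x, which is 0.\<close>

lemma commuting_psd_sqrt_unique:
  assumes B: "B \<in> carrier_mat n n" "pos_semidef_mat B"
    and C: "C \<in> carrier_mat n n" "pos_semidef_mat C"
    and sq: "B * B = C * C" and comm: "B * C = C * B"
  shows "B = C"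
proof -
  let ?D = "B - C"
  have D: "?D \<in> carrier_mat n n" using B C by (simp add: minus_carrier_mat)
  have symD: "transpose_mat ?D = ?D"
    using B C by (simp add: transpose_minus[of _ n n] pos_semidef_mat_def)
  have BC: "B * ?D + C * ?D = 0\<^sub>m n n"
    using B C sq comm by (simp add: mult_minus_distrib_mat[of _ n n] ) (rule eq_matI, auto)
  have D0: "?D *\<^sub>v x = 0\<^sub>v n" if x: "x \<in> carrier_vec n" for x
  proof -
    define y where "y = ?D *\<^sub>v x"
    have y: "y \<in> carrier_vec n" using D x by (simp add: y_def)
    have "B *\<^sub>v y + C *\<^sub>v y = (B * ?D + C * ?D) *\<^sub>v x"
      using B C D x by (simp add: y_def add_mult_distrib_mat_vec[of _ n n])
    then have "B *\<^sub>v y + C *\<^sub>v y = 0\<^sub>v n" using x BC by (simp, intro eq_vecI) auto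
    then have "y \<bullet> (B *\<^sub>v y) + y \<bullet> (C *\<^sub>v y) = 0"
      using B C y scalar_prod_add_distrib[of y n "B *\<^sub>v y" "C *\<^sub>v y"] by simp
    moreover have "y \<bullet> (B *\<^sub>v y) \<ge> 0" "y \<bullet> (C *\<^sub>v y) \<ge> 0"
      using B C y by (auto simp: pos_semidef_mat_def)
    ultimately have "y \<bullet> (B *\<^sub>v y) = 0" "y \<bullet> (C *\<^sub>v y) = 0" by linarith+
    then have "B *\<^sub>v y = 0\<^sub>v n" "C *\<^sub>v y = 0\<^sub>v n"
      using psd_eq_0_if_quadratic_form_0[OF B y] psd_eq_0_if_quadratic_form_0[OF C y] by auto
    then have Dy: "?D *\<^sub>v y = 0\<^sub>v n"
      using B C y by (simp add: minus_mult_distrib_mat_vec[of _ n n])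
    have "y \<bullet> y = (transpose_mat ?D *\<^sub>v y) \<bullet> x"
      using transpose_vec_mult_scalar[OF D x y] by (simp add: y_def)
    then have "y \<bullet> y = 0" using x by (simp add: symD Dy)
    then show ?thesis using y conjugate_square_eq_0_vec[of y n] by (simp add: y_def)
  qed
  have entry: "M $$ (i, j) = (M *\<^sub>v unit_vec n j) $ i"
    if "M \<in> carrier_mat n n" "i < n" "j < n" for M :: "real mat" and i j
    using that by simp
  have "?D $$ (i, j) = 0" if "i < n" "j < n" for i j
  proof -
    have "?D $$ (i, j) = (?D *\<^sub>v unit_vec n j) $ i"
      using entry[OF D that] .
    then show ?thesis using D0[of "unit_vec n j"] that by simp
  qed
  then show ?thesis using B(1) C(1) by (intro eq_matI) auto
qed

section \<open>Annihilating polynomial and absolute value\<close>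

lemma symmetric_mat_sq_annihilated:
  fixes A :: "real mat"
  assumes A: "A \<in> carrier_mat n n" "transpose_mat A = A"
    and ev: "\<And>e. eigenvalue A e \<Longrightarrow> e\<^sup>2 = p \<or> e\<^sup>2 = q"
  shows "A * A * (A * A) - (p + q) \<cdot>\<^sub>m (A * A) + (p * q) \<cdot>\<^sub>m 1\<^sub>m n = 0\<^sub>m n n"
proof -
  obtain es where es: "char_poly A = (\<Prod>e\<leftarrow>es. [:- e, 1:])"
    using char_poly_symmetric_splits[OF A] .
  obtain U P Q where schur: "schur_decomposition A es = (U, P, Q)"
    by (cases "schur_decomposition A es") auto
  have sim: "similar_mat_wit A U P Q" and U: "upper_triangular U" and diag: "diag_mat U = es"
    using schur_decomposition[OF A(1) es schur] by auto
  note w = similar_mat_witD2[OF A(1) sim]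
  \<comment> \<open>The diagonal of the Schur form lists the roots of the characteristic polynomial,
    so \<open>ev\<close> applies to each entry.\<close>
  have diag_sq: "(U $$ (i, i))\<^sup>2 = p \<or> (U $$ (i, i))\<^sup>2 = q" if i: "i < n" for i
  proof -
    have "U $$ (i, i) \<in> set es" using i w(5) diag[symmetric] by (auto simp: diag_mat_def)
    then have "poly (char_poly A) (U $$ (i, i)) = 0"
      unfolding es by (auto simp: poly_prod_list prod_list_zero_iff)
    then show ?thesis using ev eigenvalue_root_char_poly[OF A(1)] by simp
  qed
  \<comment> \<open>This is (X^2 - p)(X^2 - q) expanded. Conjugation by \<open>P\<close> and
    \<open>Q\<close> respects products and linear combinations, so it carries \<open>?f U\<close> to
    \<open>?f A\<close>.\<close>
  let ?f = "\<lambda>X :: real mat. X * X * (X * X) - (p + q) \<cdot>\<^sub>m (X * X) + (p * q) \<cdot>\<^sub>m 1\<^sub>m n"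
  have conj_mult: "P * X * Q * (P * Y * Q) = P * (X * Y) * Q"
    if "X \<in> carrier_mat n n" "Y \<in> carrier_mat n n" for X Y
  proof -
    have "P * X * Q * (P * Y * Q) = P * X * (Q * P) * Y * Q"
      using w(4-7) that by (simp add: assoc_mult_mat[of _ n n _ n _ n] del: w(2))
    then show ?thesis using w(2,4-7) that by (simp add: assoc_mult_mat[of _ n n _ n _ n])
  qed
  have U2: "U * U \<in> carrier_mat n n" using w(5) by simp
  have U4: "U * U * (U * U) \<in> carrier_mat n n" using mult_carrier_mat[OF U2 U2] .
  have conj_lin: "P * (X - c \<cdot>\<^sub>m Y + d \<cdot>\<^sub>m 1\<^sub>m n) * Q = P * X * Q - c \<cdot>\<^sub>m (P * Y * Q) + d \<cdot>\<^sub>m (P * Q)"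
    if XY: "X \<in> carrier_mat n n" "Y \<in> carrier_mat n n" for X Y c d
  proof -
    have PX: "P * X \<in> carrier_mat n n" "P * Y \<in> carrier_mat n n" using w(6) XY by auto
    have "P * (X - c \<cdot>\<^sub>m Y + d \<cdot>\<^sub>m 1\<^sub>m n) = P * X - c \<cdot>\<^sub>m (P * Y) + d \<cdot>\<^sub>m P"
      using w(6) XY
      by (simp add: mult_add_distrib_mat[of _ n n _ n] mult_minus_distrib_mat[of _ n n _ n]
          mult_smult_distrib[of _ n n _ n] minus_carrier_mat)
    then show ?thesis
      using w(6,7) PX
      by (simp add: add_mult_distrib_mat[of _ n n] minus_mult_distrib_mat[of _ n n]
          mult_smult_assoc_mat[of _ n n _ n] minus_carrier_mat del: assoc_mult_mat)
  qed
  have "?f A = P * ?f U * Q"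
    using conj_mult[OF w(5) w(5)] conj_mult[OF U2 U2] conj_lin[OF U4 U2] w(1,3) by simp
  then have "similar_mat_wit (?f A) (?f U) P Q"
    using w A(1) by (intro similar_mat_witI[of _ _ n]) (auto simp: minus_carrier_mat)
  moreover have "upper_triangular (?f U)" and "\<And>i. i < n \<Longrightarrow> ?f U $$ (i, i) = 0"
  proof -
    note t = upper_triangular_mult[OF w(5) U w(5) U]
    note tt = upper_triangular_mult[OF U2 t(1) U2 t(1)]
    show "upper_triangular (?f U)"
      using upper_triangularD[OF t(1)] upper_triangularD[OF tt(1)] w(5)
      by (intro upper_triangularI) (simp del: index_mult_mat(1))
    fix i assume i: "i < n"
    have "?f U $$ (i, i) = ((U $$ (i, i))\<^sup>2 - p) * ((U $$ (i, i))\<^sup>2 - q)"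
      using i w(5) t(2)[OF i] tt(2)[OF i] by (simp add: power2_eq_square algebra_simps)
    then show "?f U $$ (i, i) = 0" using diag_sq[OF i] by auto
  qed
  moreover have "transpose_mat (?f A) = ?f A"
  proof -
    have A2: "A * A \<in> carrier_mat n n" using A(1) by simp
    have "transpose_mat (A * A) = A * A"
      using A by (simp add: transpose_mult[of _ n n _ n])
    then have sym2: "transpose_mat (A * A) = A * A" and
      sym4: "transpose_mat (A * A * (A * A)) = A * A * (A * A)"
      using transpose_mult[OF A2 A2] by auto
    note symmetric_mat_index[OF sym2 A2] symmetric_mat_index[OF sym4 mult_carrier_mat[OF A2 A2]]
    then show ?thesis using A(1) by (intro eq_matI) (simp_all del: index_mult_mat(1) assoc_mult_mat)
  qed
  ultimately show ?thesis
    using A(1) symmetric_mat_eq_0_if_similar_strictly_upper[of "?f A" n "?f U" P Q]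
    by (auto simp: minus_carrier_mat)
qed

text \<open>The polynomial (t^2 + ab)/(a + b) interpolates |t| wherever |t| is \<open>a\<close> or
  \<open>b\<close>: for instance (a^2 + ab)/(a + b) = a.\<close>

lemma abs_mat_two_values:
  fixes A :: "real mat"
  assumes A: "A \<in> carrier_mat n n" "transpose_mat A = A"
    and ab: "a \<ge> 0" "b \<ge> 0" "a + b > 0"
    and ev: "\<And>e. eigenvalue A e \<Longrightarrow> \<bar>e\<bar> = a \<or> \<bar>e\<bar> = b"
  shows "abs_mat A = (1 / (a + b)) \<cdot>\<^sub>m (A * A + (a * b) \<cdot>\<^sub>m 1\<^sub>m n)" (is "_ = ?B")
proof -
  let ?T = "A * A"
  have T: "?T \<in> carrier_mat n n" using A by simp
  have B: "?B \<in> carrier_mat n n" using A by simp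
  have symT: "transpose_mat ?T = ?T" using A by (simp add: transpose_mult[of _ n n _ n])
  have symB: "transpose_mat ?B = ?B"
  proof -
    note symmetric_mat_index[OF symT T]
    then show ?thesis using A(1) by (intro eq_matI) (simp_all del: index_mult_mat(1) assoc_mult_mat)
  qed
  have "0 \<le> x \<bullet> (?B *\<^sub>v x)" if x: "x \<in> carrier_vec n" for x
  proof -
    have Ax: "A *\<^sub>v x \<in> carrier_vec n" using A x by simp
    \<comment> \<open>The form of \<open>?B\<close> at \<open>x\<close> is thus a nonnegative
      combination of the squared norms of \<open>A *\<^sub>v x\<close> and \<open>x\<close>.\<close>
    have TX: "x \<bullet> (?T *\<^sub>v x) = (A *\<^sub>v x) \<bullet> (A *\<^sub>v x)"
      using transpose_vec_mult_scalar[OF A(1) Ax x] A x by simp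
    have sm: "(k \<cdot>\<^sub>m M) *\<^sub>v x = k \<cdot>\<^sub>v (M *\<^sub>v x)" if "M \<in> carrier_mat n n" for k :: real and M
      using that x by (intro eq_vecI) auto
    have "x \<bullet> (?B *\<^sub>v x) = 1 / (a + b) * ((A *\<^sub>v x) \<bullet> (A *\<^sub>v x) + a * b * (x \<bullet> x))"
      using x T TX by (simp add: sm add_mult_distrib_mat_vec[of _ n n]
          scalar_prod_add_distrib[of _ n] scalar_prod_smult_distrib[of _ n])
    also have "\<dots> \<ge> 0"
      using ab conjugate_square_ge_0_vec[of x] conjugate_square_ge_0_vec[of "A *\<^sub>v x"]
      by (intro mult_nonneg_nonneg add_nonneg_nonneg) auto
    finally show ?thesis .
  qed
  then have psdB: "pos_semidef_mat ?B"
    using symB A(1) by (simp add: pos_semidef_mat_def)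
  have BB: "?B * ?B = ?T"
  proof -
    have ann: "?T * ?T - (a\<^sup>2 + b\<^sup>2) \<cdot>\<^sub>m ?T + (a\<^sup>2 * b\<^sup>2) \<cdot>\<^sub>m 1\<^sub>m n = 0\<^sub>m n n"
      using ev by (intro symmetric_mat_sq_annihilated[OF A]) (metis power2_abs)
    let ?R = "?T + (a * b) \<cdot>\<^sub>m 1\<^sub>m n"
    have R: "?R \<in> carrier_mat n n" using T by simp
    have RR: "?R * ?R = ?T * ?T + (a * b) \<cdot>\<^sub>m ?T + (a * b) \<cdot>\<^sub>m ?T + (a * b * (a * b)) \<cdot>\<^sub>m 1\<^sub>m n"
    proof -
      have "?R * ?R = ?T * ?R + (a * b) \<cdot>\<^sub>m ?R"
        using T R by (simp add: add_mult_distrib_mat[of _ n n _ _ n] mult_smult_assoc_mat[of _ n n _ n]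
            del: assoc_mult_mat)
      also have "?T * ?R = ?T * ?T + (a * b) \<cdot>\<^sub>m ?T"
        using T by (simp add: mult_add_distrib_mat[of _ n n _ n] mult_smult_distrib[of _ n n _ n]
            right_mult_one_mat[OF T] del: assoc_mult_mat)
      finally show ?thesis
        using A(1) by (intro eq_matI) (simp_all add: distrib_left del: index_mult_mat(1) assoc_mult_mat)
    qed
    have "?B * ?B = (1 / (a + b) * (1 / (a + b))) \<cdot>\<^sub>m
        (?T * ?T + (a * b) \<cdot>\<^sub>m ?T + (a * b) \<cdot>\<^sub>m ?T + (a * b * (a * b)) \<cdot>\<^sub>m 1\<^sub>m n)"
      unfolding RR[symmetric]
      using R by (simp add: mult_smult_distrib[of _ n n _ n] mult_smult_assoc_mat[of _ n n _ n]
          del: assoc_mult_mat) (intro eq_matI, simp_all del: index_mult_mat(1) assoc_mult_mat)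
    also have "\<dots> = ?T"
    proof (rule eq_matI)
      fix i j assume ij: "i < dim_row ?T" "j < dim_col ?T"
      then have ijn: "i < n" "j < n" using A by auto
      \<comment> \<open>Entrywise the claim is linear in \<open>t\<close>, \<open>u\<close>,
        \<open>v\<close>. Eliminating \<open>u\<close> by the annihilating identity cancels the
        \<open>v\<close> terms and leaves (a^2 + b^2 + 2ab)t = (a + b)^2 t.\<close>
      define t u v :: real where "t = ?T $$ (i, j)" and "u = (?T * ?T) $$ (i, j)" and "v = (1\<^sub>m n) $$ (i, j)"
      have "u - (a\<^sup>2 + b\<^sup>2) * t + a\<^sup>2 * b\<^sup>2 * v = 0"
        using arg_cong[OF ann, of "\<lambda>M. M $$ (i, j)"] A(1) ijn
        by (simp add: t_def u_def v_def del: index_mult_mat(1) index_one_mat(1))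
      then have u: "u = (a\<^sup>2 + b\<^sup>2) * t - a\<^sup>2 * b\<^sup>2 * v" by simp
      have "1 / (a + b) * (1 / (a + b)) * (u + a * b * t + a * b * t + a * b * (a * b) * v) = t"
      proof -
        have "u + a * b * t + a * b * t + a * b * (a * b) * v = (a + b) * ((a + b) * t)"
          unfolding u by (simp add: power2_eq_square algebra_simps)
        then show ?thesis using ab by simp
      qed
      then show "((1 / (a + b) * (1 / (a + b))) \<cdot>\<^sub>m
        (?T * ?T + (a * b) \<cdot>\<^sub>m ?T + (a * b) \<cdot>\<^sub>m ?T + (a * b * (a * b)) \<cdot>\<^sub>m 1\<^sub>m n)) $$ (i, j) = ?T $$ (i, j)"
        using A(1) ijn
        by (simp add: t_def u_def v_def del: index_mult_mat(1) index_one_mat(1))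
    qed (use A in auto)
    finally show ?thesis .
  qed
  have "C = ?B" if C: "pos_semidef_mat C" "C * C = ?T" for C
  proof (rule commuting_psd_sqrt_unique[OF _ C(1) B psdB])
    \<comment> \<open>The size of a competing root is not given: symmetry makes it square, and the
      equation for its square fixes the dimension.\<close>
    have "dim_row C = dim_col C"
      using C(1) by (metis index_transpose_mat(2) pos_semidef_mat_def)
    moreover have "dim_row C = n" using arg_cong[OF C(2), of dim_row] A(1) by simp
    ultimately show Cn: "C \<in> carrier_mat n n" by auto
    show "C * C = ?B * ?B" unfolding BB by (fact C(2))
    \<comment> \<open>Both sides are the cube of \<open>C\<close>.\<close>
    have CT: "C * ?T = ?T * C"
      using Cn by (simp add: C(2)[symmetric] assoc_mult_mat[of _ n n _ n _ n])
    have "C * ?B = (1 / (a + b)) \<cdot>\<^sub>m (C * ?T + (a * b) \<cdot>\<^sub>m C)"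
      using Cn T by (simp add: mult_smult_distrib[of _ n n _ n] mult_add_distrib_mat[of _ n n _ n] del: assoc_mult_mat)
    also have "\<dots> = ?B * C"
      unfolding CT
      using Cn T by (simp add: mult_smult_assoc_mat[of _ n n _ n] add_mult_distrib_mat[of _ n n] del: assoc_mult_mat)
    finally show "C * ?B = ?B * C" .
  qed
  then show ?thesis
    unfolding abs_mat_def psd_sqrt_mat_def using psdB BB by (intro the_equality) blast+
qed

section \<open>Application to the Seidel matrix\<close>

theorem proposition2:
  fixes G :: "('a, 'b) pre_digraph" and vs :: "'a list" and n :: nat and a b :: real
  assumes "graph G"
    and "distinct vs" and "set vs = verts G" and "length vs = n"
    and "a > b" and "b \<ge> 0"
    and "{\<bar>\<theta>\<bar> | \<theta>. eigenvalue (seidel_matrix G vs) \<theta>} = {a, b}"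
  shows "\<forall>i<n. vertex_seidel_energy G vs i = b + (a - b) * ((real n - 1 - b\<^sup>2) / (a\<^sup>2 - b\<^sup>2))"
proof (intro allI impI)
  fix i assume i: "i < n"
  interpret graph G by fact
  let ?S = "seidel_matrix G vs"
  have S: "?S \<in> carrier_mat n n" using assms(4) by (simp add: seidel_matrix_def)
  have adj: "u \<rightarrow>\<^bsub>G\<^esub> v \<longleftrightarrow> v \<rightarrow>\<^bsub>G\<^esub> u" for u v
    using sym_arcs by (auto simp: symmetric_def dest: symD)
  have symS: "transpose_mat ?S = ?S"
    by (rule eq_matI) (auto simp: seidel_matrix_def adj)
  have ev: "\<bar>e\<bar> = a \<or> \<bar>e\<bar> = b" if "eigenvalue ?S e" for e
    using assms(7) that by auto
  have "(?S * ?S) $$ (i, i) = (\<Sum>j<n. ?S $$ (i, j) * ?S $$ (j, i))"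
    using S i by (simp add: scalar_prod_def lessThan_atLeast0)
  \<comment> \<open>By symmetry of adjacency each product is the square of an entry, which is 1 or
    -1 off the diagonal and 0 on it.\<close>
  also have "\<dots> = (\<Sum>j<n. if j = i then 0 else 1)"
    using i assms(4) adj by (intro sum.cong) (auto simp: seidel_matrix_def)
  also have "\<dots> = (\<Sum>j\<in>{..<n} - {i}. 1)"
    by (intro sum.mono_neutral_cong_right) auto
  also have "\<dots> = real n - 1" using i by (simp add: of_nat_diff)
  finally have diag: "(?S * ?S) $$ (i, i) = real n - 1" .
  have "vertex_seidel_energy G vs i = (real n - 1 + a * b) / (a + b)"
    unfolding vertex_seidel_energy_def
    using abs_mat_two_values[OF S symS _ _ _ ev] assms(5,6) S i diag
    by (simp del: index_mult_mat(1))
  also have "\<dots> = b + (a - b) * ((real n - 1 - b\<^sup>2) / (a\<^sup>2 - b\<^sup>2))"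
  proof -
    \<comment> \<open>Since a > b, the factor a - b cancels, and b(a + b) - b^2 = ab gives the
      stated form.\<close>
    have "a\<^sup>2 - b\<^sup>2 = (a - b) * (a + b)" by (simp add: power2_eq_square algebra_simps)
    then have "(a - b) * ((real n - 1 - b\<^sup>2) / (a\<^sup>2 - b\<^sup>2)) = (real n - 1 - b\<^sup>2) / (a + b)"
      using assms(5) by simp
    moreover have "b + (real n - 1 - b\<^sup>2) / (a + b) = (real n - 1 + a * b) / (a + b)"
      using assms(5,6) by (simp add: field_simps power2_eq_square)
    ultimately show ?thesis by simp
  qed
  finally show "vertex_seidel_energy G vs i = b + (a - b) * ((real n - 1 - b\<^sup>2) / (a\<^sup>2 - b\<^sup>2))" .
qed

end
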